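(* Let $\mathbf X$ be a zero-mean Gaussian random vector in $\mathbb R^n$ with a nonsingular covariance matrix $\Sigma$, let $w\colon\mathbb R^n\to[0,\infty)$ be an even unimodal function with $\mathsf E\,w(\mathbf X)>0$, and let $\mathbf u\in\mathbb R^n$ be a unit vector. If $\mathsf E\,w(\mathbf X)<\infty$, then for any real $t\ge0$ $$\frac{d}{dt}\,\mathsf E\,w(\mathbf X-t\mathbf u)\ge-t\,\langle\mathbf u,\Sigma^{-1}\mathbf u\rangle\,\mathsf E\,w(\mathbf X-t\mathbf u).$$
   Context: $\langle\cdot,\cdot\rangle$ is the standard inner product on $\mathbb R^n$. A function $w\colon\mathbb R^n\to[0,\infty)$ is even if $w(-\mathbf x)=w(\mathbf x)$ for all $\mathbf x$, and unimodal if the set $\{\mathbf x\in\mathbb R^n\colon w(\mathbf x)>c\}$ is convex for each real $c$. (Convex sets are Lebesgue measurable; expectations are integrals against the Gaussian density with respect to Lebesgue measure.) *)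

theory Defs
  imports "HOL-Probability.Probability"
begin

(* Unimodal functions are Lebesgue measurable but need not be Borel measurable, so w o X
   need not be measurable on M itself. Expectations are therefore taken over the completion
   of M; for integrands measurable on M this is the usual expectation, and for X with a
   density it is the integral against that density with respect to Lebesgue measure
   (lemma expect_eq_lebesgue_integral). *)

definition expect :: "'a measure \<Rightarrow> ('a \<Rightarrow> 'b::{banach, second_countable_topology}) \<Rightarrow> 'b" where
  "expect M f = integral\<^sup>L (completion M) f"

definition mean_vector :: "'a measure \<Rightarrow> ('a \<Rightarrow> real ^ 'n) \<Rightarrow> real ^ 'n" where
  "mean_vector M X = expect M X"

definition covariance_matrix :: "'a measure \<Rightarrow> ('a \<Rightarrow> real ^ 'n) \<Rightarrow> real ^ 'n ^ 'n" where
  "covariance_matrix M X =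
     (\<chi> i j. expect M (\<lambda>\<omega>. (X \<omega> $ i - mean_vector M X $ i) * (X \<omega> $ j - mean_vector M X $ j)))"

definition gaussian_density :: "real ^ 'n \<Rightarrow> real ^ 'n ^ 'n \<Rightarrow> real ^ 'n \<Rightarrow> real" where
  "gaussian_density \<mu> \<Sigma> x =
     exp (- ((x - \<mu>) \<bullet> (matrix_inv \<Sigma> *v (x - \<mu>))) / 2) / sqrt ((2 * pi) ^ CARD('n) * det \<Sigma>)"

(* A Gaussian random vector whose covariance matrix is nonsingular: the density is the Gaussian
   one formed from the actual mean and covariance of X. Square integrability makes these Bochner
   integrals genuine moments. In the singular case det = 0 the formula above gives 0, which is
   not a probability density, so degenerate Gaussian vectors are excluded. *)

definition nondegenerate_gaussian :: "'a measure \<Rightarrow> ('a \<Rightarrow> real ^ 'n) \<Rightarrow> bool" where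
  "nondegenerate_gaussian M X \<longleftrightarrow>
     X \<in> borel_measurable M \<and> integrable M (\<lambda>\<omega>. (norm (X \<omega>))\<^sup>2) \<and>
     invertible (covariance_matrix M X) \<and>
     distributed M lborel X
       (\<lambda>x. ennreal (gaussian_density (mean_vector M X) (covariance_matrix M X) x))"

definition even_function :: "(real ^ 'n \<Rightarrow> real) \<Rightarrow> bool" where
  "even_function w \<longleftrightarrow> (\<forall>x. w (- x) = w x)"

definition unimodal :: "(real ^ 'n \<Rightarrow> real) \<Rightarrow> bool" where
  "unimodal w \<longleftrightarrow> (\<forall>c. convex {x. w x > c})"

lemma expect_eq_lebesgue_integral:
  fixes X :: "'a \<Rightarrow> real ^ 'n" and g h :: "real ^ 'n \<Rightarrow> real"
  assumes X: "distributed M lborel X (\<lambda>x. ennreal (g x))"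
    and g: "\<And>x. 0 \<le> g x"
    and h: "h \<in> borel_measurable lebesgue"
  shows "expect M (\<lambda>\<omega>. h (X \<omega>)) = (\<integral>x. g x * h x \<partial>lebesgue)"
proof -
  obtain k where k: "k \<in> borel_measurable lborel" and hk: "AE x in lborel. h x = k x"
    using completion_ex_borel_measurable_real[OF h] by auto
  have gm[measurable]: "g \<in> borel_measurable lborel"
    using X g by (intro distributed_real_measurable) auto
  have Xm: "X \<in> M \<rightarrow>\<^sub>M lborel"
    using X by (simp add: distributed_def)
  have "AE x in distr M lborel X. h x = k x"
    unfolding distributed_distr_eq_density[OF X]
    by (subst AE_density) (use hk in auto)
  then have ae: "AE \<omega> in completion M. h (X \<omega>) = k (X \<omega>)"
    by (intro AE_completion AE_distrD[OF Xm])
  have kX: "(\<lambda>\<omega>. k (X \<omega>)) \<in> borel_measurable M"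
    using measurable_compose[OF Xm k] .
  have hX: "(\<lambda>\<omega>. h (X \<omega>)) \<in> borel_measurable (completion M)"
  proof -
    have "null_sets (lborel :: (real ^ 'n) measure) \<subseteq> null_sets (distr (completion M) lborel X)"
    proof
      fix S assume S: "S \<in> null_sets (lborel :: (real ^ 'n) measure)"
      then have "S \<in> null_sets (density lborel (\<lambda>x. ennreal (g x)))"
        by (subst null_sets_density_iff) (use AE_not_in[OF S] in auto)
      then show "S \<in> null_sets (distr (completion M) lborel X)"
        using distributed_distr_eq_density[OF X] by (simp add: distr_completion[OF Xm])
    qed
    then have "X \<in> completion M \<rightarrow>\<^sub>M lebesgue"
      by (intro completion.measurable_completion2 measurable_completion Xm)
    then show ?thesis
      using h by (rule measurable_compose)
  qed
  have "expect M (\<lambda>\<omega>. h (X \<omega>)) = (\<integral>\<omega>. k (X \<omega>) \<partial>completion M)"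
    unfolding expect_def by (intro integral_cong_AE hX measurable_completion kX ae)
  also have "\<dots> = (\<integral>x. g x * k x \<partial>lborel)"
    using distributed_integral[OF X k] g by (simp add: integral_completion[OF kX])
  also have "\<dots> = (\<integral>x. g x * k x \<partial>lebesgue)"
    by (intro integral_completion[symmetric] borel_measurable_times gm k)
  also have "\<dots> = (\<integral>x. g x * h x \<partial>lebesgue)"
    by (intro integral_cong_AE borel_measurable_times h measurable_completion gm k)
       (use AE_completion[OF hk] in auto)
  finally show ?thesis .
qed

end

theory Submission
  imports Defs
begin

text \<open>
  Write \<open>g\<close> for the density of \<open>X\<close>, \<open>q = \<langle>u, \<Sigma>\<^sup>-\<^sup>1 u\<rangle>\<close> and \<open>b x = \<langle>x, \<Sigma>\<^sup>-\<^sup>1 u\<rangle>\<close>. Translating the variable and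
  completing the square gives
  \<open>E w(X - t u) = \<integral> g(y + t u) w(y) dy = exp (- t\<^sup>2 q / 2) * G t\<close> with
  \<open>G t = \<integral> g(y) w(y) exp (- t b(y)) dy\<close>. The derivative of the Gaussian factor produces exactly
  the right-hand side \<open>- t q E w(X - t u)\<close>, so the claim is that \<open>G' t \<ge> 0\<close> for \<open>t \<ge> 0\<close>. But \<open>G\<close> is a
  moment generating function, hence convex, and it is even because \<open>g\<close> and \<open>w\<close> are even and \<open>b\<close> is odd;
  an even convex function is nondecreasing on the half-line (\<open>even_mgf_deriv_nonneg\<close>).

  Unimodality provides the regularity. A nonempty symmetric convex set contains the origin, so
  \<open>w\<close> is bounded by \<open>w 0\<close> (\<open>even_unimodal_le_at_zero\<close>), and all integrals converge because the
  Gaussian density has all exponential moments; convex sets have negligible frontier, so \<open>w\<close> is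
  Lebesgue measurable (\<open>unimodal_lebesgue_measurable\<close>).
\<close>

section \<open>Even unimodal functions\<close>

lemma convex_lebesgue_measurable:
  fixes S :: "'a::euclidean_space set"
  assumes "convex S"
  shows "S \<in> sets lebesgue"
proof -
  have "S \<inter> frontier S \<in> null_sets lebesgue"
    using negligible_convex_frontier[OF assms] negligible_subset
    by (metis inf_le2 negligible_iff_null_sets)
  moreover have "interior S \<in> sets lebesgue"
    by simp
  moreover have "S = interior S \<union> (S \<inter> frontier S)"
    using interior_subset closure_subset unfolding frontier_def by blast
  ultimately show ?thesis
    by (metis null_setsD2 sets.Un)
qed

lemma unimodal_lebesgue_measurable:
  assumes "unimodal w"
  shows "w \<in> borel_measurable lebesgue"
  using assms unfolding unimodal_def
  by (intro borel_measurableI_greater) (simp add: convex_lebesgue_measurable)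

text \<open>
  If \<open>w x > w 0\<close>, the set \<open>{y. w y > w 0}\<close> contains \<open>x\<close> and \<open>- x\<close>, hence by convexity their midpoint \<open>0\<close>.
\<close>

lemma even_unimodal_le_at_zero:
  assumes "even_function w" "unimodal w"
  shows "w x \<le> w 0"
proof (rule ccontr)
  assume "\<not> w x \<le> w 0"
  then have "x \<in> {y. w y > w 0}" "- x \<in> {y. w y > w 0}"
    using assms(1) by (auto simp: even_function_def)
  moreover have "convex {y. w y > w 0}"
    using assms(2) by (simp add: unimodal_def)
  ultimately have "(1/2) *\<^sub>R x + (1/2) *\<^sub>R (- x) \<in> {y. w y > w 0}"
    by (intro convexD) auto
  then show False by simp
qed

section \<open>Weighted moment generating functions\<close>

lemma abs_exp_minus_one_le:
  fixes y :: real
  shows "\<bar>exp y - 1\<bar> \<le> \<bar>y\<bar> * exp \<bar>y\<bar>"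
proof (cases "y \<ge> 0")
  case True
  have "(1 - y) * exp y \<le> exp (- y) * exp y"
    using exp_ge_add_one_self[of "- y"] by (intro mult_right_mono) auto
  then show ?thesis
    using True by (simp add: algebra_simps flip: exp_add)
next
  case False
  then have "\<bar>exp y - 1\<bar> \<le> \<bar>y\<bar> * 1"
    using exp_ge_add_one_self[of y] exp_le_one_iff[of y] by linarith
  also have "\<dots> \<le> \<bar>y\<bar> * exp \<bar>y\<bar>"
    by (intro mult_left_mono) auto
  finally show ?thesis .
qed

lemma abs_mult_exp_abs_le:
  fixes b :: real
  shows "\<bar>b\<bar> * exp \<bar>b\<bar> \<le> exp (2 * b) + exp (- 2 * b)"
proof -
  have "\<bar>b\<bar> * exp \<bar>b\<bar> \<le> exp \<bar>b\<bar> * exp \<bar>b\<bar>"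
    using exp_ge_add_one_self[of "\<bar>b\<bar>"] by (intro mult_right_mono) linarith+
  also have "\<dots> = exp (2 * \<bar>b\<bar>)"
    by (simp flip: exp_add)
  also have "\<dots> \<le> exp (2 * b) + exp (- 2 * b)"
    by (cases "b \<ge> 0") auto
  finally show ?thesis .
qed

text \<open>
  Differentiation under the integral sign. For \<open>\<bar>r - s\<bar> \<le> 1\<close> the difference quotients of
  \<open>r \<mapsto> exp (r b)\<close> at \<open>s\<close> are at most \<open>exp (s b) \<bar>b\<bar> exp \<bar>b\<bar> \<le> exp ((s + 2) b) + exp ((s - 2) b)\<close>, which is
  integrable against \<open>h\<close>; dominated convergence applies.
\<close>

lemma
  fixes h b :: "'a \<Rightarrow> real"
  assumes b[measurable]: "b \<in> borel_measurable N"
    and int: "\<And>s. integrable N (\<lambda>x. h x * exp (s * b x))"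
  shows integrable_mgf_deriv: "integrable N (\<lambda>x. h x * (b x * exp (s * b x)))"
    and DERIV_mgf: "((\<lambda>s. \<integral>x. h x * exp (s * b x) \<partial>N) has_real_derivative
           (\<integral>x. h x * (b x * exp (s * b x)) \<partial>N)) (at s)"
proof -
  have h[measurable]: "h \<in> borel_measurable N"
    using borel_measurable_integrable[OF int[of 0]] by simp
  define B where "B x = \<bar>h x * exp ((s + 2) * b x)\<bar> + \<bar>h x * exp ((s - 2) * b x)\<bar>" for x
  have B_int: "integrable N B"
    unfolding B_def by (intro Bochner_Integration.integrable_add integrable_abs int)
  have B_eq: "B x = \<bar>h x\<bar> * (exp (s * b x) * (exp (2 * b x) + exp (- 2 * b x)))" for x
    by (simp add: B_def abs_mult algebra_simps flip: exp_add)
  have B_ge: "\<bar>h x\<bar> * (exp (s * b x) * c) \<le> B x" if "c \<le> \<bar>b x\<bar> * exp \<bar>b x\<bar>" for x c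
    unfolding B_eq using that abs_mult_exp_abs_le[of "b x"] by (intro mult_left_mono) auto
  show "integrable N (\<lambda>x. h x * (b x * exp (s * b x)))"
  proof (rule Bochner_Integration.integrable_bound[OF B_int])
    show "AE x in N. norm (h x * (b x * exp (s * b x))) \<le> norm (B x)"
    proof (rule AE_I2)
      fix x
      have "\<bar>b x\<bar> * 1 \<le> \<bar>b x\<bar> * exp \<bar>b x\<bar>"
        by (intro mult_left_mono) auto
      then have "\<bar>h x\<bar> * (exp (s * b x) * \<bar>b x\<bar>) \<le> B x"
        by (intro B_ge) auto
      then show "norm (h x * (b x * exp (s * b x))) \<le> norm (B x)"
        by (simp add: abs_mult mult_ac)
    qed
  qed measurable
  let ?I = "{s - 1<..<s + 1}"
  let ?G = "\<lambda>s. \<integral>x. h x * exp (s * b x) \<partial>N"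
  let ?D = "\<integral>x. h x * (b x * exp (s * b x)) \<partial>N"
  have "(?G has_real_derivative ?D) (at s within ?I)"
    unfolding has_field_derivative_iff tendsto_at_iff_sequentially
  proof (intro allI impI)
    fix r assume r: "\<forall>i. r i \<in> ?I - {s}" and lim: "r \<longlonglongrightarrow> s"
    let ?Q = "\<lambda>i x. h x * ((exp (r i * b x) - exp (s * b x)) / (r i - s))"
    have "(\<lambda>i. \<integral>x. ?Q i x \<partial>N) \<longlonglongrightarrow> ?D"
    proof (rule integral_dominated_convergence[where w = B])
      show "AE x in N. (\<lambda>i. ?Q i x) \<longlonglongrightarrow> h x * (b x * exp (s * b x))"
      proof (rule AE_I2)
        fix x
        have "((\<lambda>s. exp (s * b x)) has_real_derivative b x * exp (s * b x)) (at s)"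
          by (auto intro!: derivative_eq_intros)
        then have "(\<lambda>i. (exp (r i * b x) - exp (s * b x)) / (r i - s)) \<longlonglongrightarrow> b x * exp (s * b x)"
          using r lim unfolding has_field_derivative_iff tendsto_at_iff_sequentially comp_def by auto
        then show "(\<lambda>i. ?Q i x) \<longlonglongrightarrow> h x * (b x * exp (s * b x))"
          by (intro tendsto_mult tendsto_const)
      qed
      show "AE x in N. norm (?Q i x) \<le> B x" for i
      proof (rule AE_I2)
        fix x
        define k where "k = r i - s"
        have k: "k \<noteq> 0" "\<bar>k\<bar> \<le> 1" using r[rule_format, of i] by (auto simp: k_def)
        have kb: "\<bar>k * b x\<bar> \<le> \<bar>b x\<bar>"
          using k mult_right_mono[of "\<bar>k\<bar>" 1 "\<bar>b x\<bar>"] by (simp add: abs_mult)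
        have "\<bar>exp (k * b x) - 1\<bar> \<le> \<bar>k * b x\<bar> * exp \<bar>k * b x\<bar>"
          by (rule abs_exp_minus_one_le)
        also have "\<dots> \<le> \<bar>k * b x\<bar> * exp \<bar>b x\<bar>"
          using kb by (intro mult_left_mono) auto
        finally have "\<bar>exp (k * b x) - 1\<bar> / \<bar>k\<bar> \<le> \<bar>b x\<bar> * exp \<bar>b x\<bar>"
          using k by (simp add: abs_mult field_simps)
        then have "\<bar>h x\<bar> * (exp (s * b x) * (\<bar>exp (k * b x) - 1\<bar> / \<bar>k\<bar>)) \<le> B x"
          by (rule B_ge)
        moreover have "exp (r i * b x) - exp (s * b x) = exp (s * b x) * (exp (k * b x) - 1)"
          by (simp add: k_def algebra_simps flip: exp_add)
        ultimately show "norm (?Q i x) \<le> B x"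
          by (simp add: abs_mult k_def)
      qed
    qed (use B_int in measurable)
    moreover have "(\<integral>x. ?Q i x \<partial>N) = (?G (r i) - ?G s) / (r i - s)" for i
    proof -
      have "(\<integral>x. ?Q i x \<partial>N) =
          (\<integral>x. (h x * exp (r i * b x) - h x * exp (s * b x)) / (r i - s) \<partial>N)"
        by (simp only: right_diff_distrib times_divide_eq_right)
      also have "\<dots> = (?G (r i) - ?G s) / (r i - s)"
        by (simp only: integral_divide_zero Bochner_Integration.integral_diff[OF int int])
      finally show ?thesis .
    qed
    ultimately show "((\<lambda>y. (?G y - ?G s) / (y - s)) \<circ> r) \<longlonglongrightarrow> ?D"
      by (simp only: comp_def)
  qed
  then show "(?G has_real_derivative ?D) (at s)"
    by (simp add: at_within_open[of s ?I])
qed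

text \<open>
  The derivative \<open>D\<close> of an even function is odd, so \<open>2 D(s) = D(s) - D(- s)\<close>, and the difference is
  nonnegative because \<open>D\<close> is the integral, with weight \<open>h \<ge> 0\<close>, of the functions \<open>s \<mapsto> b exp (s b)\<close>, which are nondecreasing.
\<close>

lemma even_mgf_deriv_nonneg:
  fixes h b :: "'a \<Rightarrow> real"
  assumes b: "b \<in> borel_measurable N"
    and int: "\<And>s. integrable N (\<lambda>x. h x * exp (s * b x))"
    and h: "\<And>x. h x \<ge> 0"
    and even: "\<And>s. (\<integral>x. h x * exp (- s * b x) \<partial>N) = (\<integral>x. h x * exp (s * b x) \<partial>N)"
    and s: "s \<ge> 0"
  shows "(\<integral>x. h x * (b x * exp (s * b x)) \<partial>N) \<ge> 0"
proof -
  let ?G = "\<lambda>s. \<integral>x. h x * exp (s * b x) \<partial>N"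
  let ?D = "\<lambda>s. \<integral>x. h x * (b x * exp (s * b x)) \<partial>N"
  note deriv = DERIV_mgf[OF b int]
  have "((\<lambda>s. ?G (- s)) has_real_derivative - ?D (- s)) (at s)"
    using DERIV_mirror[of ?G "?D (- s)" s] deriv[of "- s"] by simp
  then have "?D s = - ?D (- s)"
    using deriv[of s] even by (intro DERIV_unique[of ?G]) simp_all
  moreover have "?D (- s) \<le> ?D s"
  proof (rule integral_mono)
    fix x
    have "b x * exp (- s * b x) \<le> b x * exp (s * b x)"
    proof (cases "b x \<ge> 0")
      case True
      then have "- s * b x \<le> s * b x" using s by simp
      then show ?thesis using True by (intro mult_left_mono) auto
    next
      case False
      then have "s * b x \<le> - s * b x" using s mult_nonneg_nonpos[of s "b x"] by simp
      then show ?thesis using False by (intro mult_left_mono_neg) auto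
    qed
    then show "h x * (b x * exp (- s * b x)) \<le> h x * (b x * exp (s * b x))"
      using h by (rule mult_left_mono)
  qed (rule integrable_mgf_deriv[OF b int])+
  ultimately show ?thesis by linarith
qed

section \<open>Lebesgue integrals under translation and reflection\<close>

lemma
  fixes a :: "'a::euclidean_space"
  assumes "\<bar>c\<bar> = 1"
  shows lebesgue_measurable_affine: "(\<lambda>x. a + c *\<^sub>R x) \<in> lebesgue \<rightarrow>\<^sub>M lebesgue"
    and distr_lebesgue_affine: "distr lebesgue lebesgue (\<lambda>x. a + c *\<^sub>R x) = lebesgue"
proof -
  have T: "(\<lambda>x. a + (\<Sum>j\<in>Basis. (c * (x \<bullet> j)) *\<^sub>R j)) = (\<lambda>x. a + c *\<^sub>R x)"
    by (simp add: euclidean_representation flip: scaleR_scaleR scaleR_sum_right)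
  have c: "c \<noteq> 0" using assms by auto
  show "(\<lambda>x. a + c *\<^sub>R x) \<in> lebesgue \<rightarrow>\<^sub>M lebesgue"
    using lebesgue_affine_measurable[of "\<lambda>_. c" a] c unfolding T by simp
  show "distr lebesgue lebesgue (\<lambda>x. a + c *\<^sub>R x) = lebesgue"
    using lebesgue_affine_euclidean[of "\<lambda>_. c" a] c assms unfolding T by (simp add: density_1)
qed

lemma
  fixes a :: "'a::euclidean_space" and f :: "'a \<Rightarrow> real"
  assumes c: "\<bar>c\<bar> = 1" and f: "f \<in> borel_measurable lebesgue"
  shows integral_lebesgue_affine: "(\<integral>x. f (a + c *\<^sub>R x) \<partial>lebesgue) = (\<integral>x. f x \<partial>lebesgue)"
    and integrable_lebesgue_affine:
      "integrable lebesgue (\<lambda>x. f (a + c *\<^sub>R x)) \<longleftrightarrow> integrable lebesgue f"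
  using integral_distr[OF lebesgue_measurable_affine[OF c, of a] f]
    integrable_distr_eq[OF lebesgue_measurable_affine[OF c, of a] f]
  by (simp_all add: distr_lebesgue_affine[OF c])

section \<open>Gaussian densities\<close>

lemma covariance_matrix_symmetric: "transpose (covariance_matrix M X) = covariance_matrix M X"
  by (simp add: covariance_matrix_def transpose_def mult.commute)

lemma symmetric_matrix_inv_inner:
  fixes S :: "real ^ 'n ^ 'n"
  assumes "invertible S" "transpose S = S"
  shows "(matrix_inv S *v x) \<bullet> y = x \<bullet> (matrix_inv S *v y)"
proof -
  let ?P = "matrix_inv S"
  have "S ** ?P = mat 1"
    using assms(1) unfolding invertible_def matrix_inv_def by (rule someI2_ex) auto
  then have SP: "S *v (?P *v z) = z" for z
    by (simp add: matrix_vector_mul_assoc)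
  have "(S *v z) \<bullet> z' = z \<bullet> (S *v z')" for z z'
    by (metis assms(2) dot_lmul_matrix vector_transpose_matrix)
  from this[of "?P *v x" "?P *v y"] show ?thesis by (simp add: SP)
qed

text \<open>
  Completing the square: translating a Gaussian density tilts it exponentially. This identifies the
  shifted expectation as a moment generating function and also shows that all exponential moments
  along \<open>u\<close> are finite, because translates of the density are integrable.
\<close>

lemma gaussian_density_translate:
  fixes S :: "real ^ 'n ^ 'n"
  assumes "invertible S" "transpose S = S"
  shows "gaussian_density 0 S (s *\<^sub>R u + x) =
    exp (- s\<^sup>2 * (u \<bullet> (matrix_inv S *v u)) / 2) *
      (gaussian_density 0 S x * exp (- s * (x \<bullet> (matrix_inv S *v u))))"
proof -
  let ?P = "matrix_inv S"
  have "u \<bullet> (?P *v x) = x \<bullet> (?P *v u)"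
    using symmetric_matrix_inv_inner[OF assms, of u x] by (simp add: inner_commute)
  then have "(s *\<^sub>R u + x) \<bullet> (?P *v (s *\<^sub>R u + x)) =
      s\<^sup>2 * (u \<bullet> (?P *v u)) + 2 * s * (x \<bullet> (?P *v u)) + x \<bullet> (?P *v x)"
    by (simp add: matrix_vector_right_distrib matrix_vector_mult_scaleR inner_add_left
        inner_add_right power2_eq_square algebra_simps)
  then have "- ((s *\<^sub>R u + x) \<bullet> (?P *v (s *\<^sub>R u + x))) / 2 =
      - s\<^sup>2 * (u \<bullet> (?P *v u)) / 2 + (- (x \<bullet> (?P *v x)) / 2 + - s * (x \<bullet> (?P *v u)))"
    by argo
  then show ?thesis
    by (simp only: gaussian_density_def exp_add diff_zero times_divide_eq_right times_divide_eq_left)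
qed

lemma gaussian_density_minus: "gaussian_density 0 S (- x) = gaussian_density 0 S x"
  using matrix_vector_mult_scaleR[of "matrix_inv S" "-1" x] by (simp add: gaussian_density_def)

text \<open>
  The formula for \<open>gaussian_density\<close> has constant sign, that of \<open>det S\<close>. A negative sign would make the
  density vanish as an extended nonnegative function, but its total mass is \<open>1\<close>.
\<close>

lemma gaussian_density_nonneg:
  fixes X :: "'a \<Rightarrow> real ^ 'n"
  assumes "prob_space M"
    and X: "distributed M lborel X (\<lambda>x. ennreal (gaussian_density \<mu> S x))"
  shows "gaussian_density \<mu> S x \<ge> 0"
proof (rule ccontr)
  assume "\<not> gaussian_density \<mu> S x \<ge> 0"
  then have "sqrt ((2 * pi) ^ CARD('n) * det S) < 0"
    unfolding gaussian_density_def by (simp add: zero_le_divide_iff)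
  then have "gaussian_density \<mu> S y \<le> 0" for y
    unfolding gaussian_density_def by (intro divide_nonneg_neg[THEN order.trans]) auto
  then have "(\<lambda>x. ennreal (gaussian_density \<mu> S x)) = (\<lambda>_. 0)"
    by (simp add: fun_eq_iff ennreal_neg)
  then have "distr M lborel X = density lborel (\<lambda>_. 0)"
    using distributed_distr_eq_density[OF X] by simp
  then have "emeasure (distr M lborel X) UNIV = 0"
    by (simp add: emeasure_density)
  moreover have "prob_space (distr M lborel X)"
    using X by (intro prob_space.prob_space_distr[OF assms(1)]) (simp add: distributed_def)
  ultimately show False
    using prob_space.emeasure_space_1[of "distr M lborel X"] by simp
qed

section \<open>Shifted expectations\<close>

text \<open>
  For \<open>w\<close> that is merely Lebesgue measurable, measurability of \<open>w \<circ> X\<close> holds on the completed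
  probability space because the law of \<open>X\<close> is absolutely continuous.
\<close>

lemma distributed_measurable_completion:
  fixes X :: "'a \<Rightarrow> 'b::euclidean_space"
  assumes X: "distributed M lborel X g"
  shows "X \<in> completion M \<rightarrow>\<^sub>M lebesgue"
proof -
  have Xm: "X \<in> M \<rightarrow>\<^sub>M lborel" and g: "g \<in> borel_measurable lborel"
    using X by (auto simp: distributed_def)
  have "null_sets lborel \<subseteq> null_sets (density lborel g)"
    using absolutely_continuousI_density[OF g] by (simp add: absolutely_continuous_def)
  also have "density lborel g = distr (completion M) lborel X"
    using distributed_distr_eq_density[OF X] by (simp add: distr_completion[OF Xm])
  finally show ?thesis
    by (intro completion.measurable_completion2 measurable_completion Xm)
qed

theorem theorem2p7:
  fixes M :: "'a measure" and X :: "'a \<Rightarrow> real ^ 'n" and \<Sigma> :: "real ^ 'n ^ 'n"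
    and w :: "real ^ 'n \<Rightarrow> real" and u :: "real ^ 'n"
  assumes "prob_space M"
    and "nondegenerate_gaussian M X"
    and "mean_vector M X = 0"
    and "covariance_matrix M X = \<Sigma>" and "invertible \<Sigma>"
    and "\<forall>x. 0 \<le> w x" and "even_function w" and "unimodal w"
    and "norm u = 1"
    and "integrable (completion M) (\<lambda>\<omega>. w (X \<omega>))"
    and "expect M (\<lambda>\<omega>. w (X \<omega>)) > 0"
  shows "(\<forall>s. integrable (completion M) (\<lambda>\<omega>. w (X \<omega> - s *\<^sub>R u))) \<and>
    (\<forall>t\<ge>0.
      (\<lambda>s. expect M (\<lambda>\<omega>. w (X \<omega> - s *\<^sub>R u))) differentiable (at t) \<and>
      deriv (\<lambda>s. expect M (\<lambda>\<omega>. w (X \<omega> - s *\<^sub>R u))) t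
        \<ge> - t * (u \<bullet> (matrix_inv \<Sigma> *v u)) * expect M (\<lambda>\<omega>. w (X \<omega> - t *\<^sub>R u)))"
proof -
  define g where "g = gaussian_density 0 \<Sigma>"
  define q where "q = u \<bullet> (matrix_inv \<Sigma> *v u)"
  define b where "b x = x \<bullet> (matrix_inv \<Sigma> *v u)" for x
  define G where "G s = (\<integral>x. g x * w x * exp (s * b x) \<partial>lebesgue)" for s
  define D where "D s = (\<integral>x. g x * w x * (b x * exp (s * b x)) \<partial>lebesgue)" for s
  have X: "distributed M lborel X (\<lambda>x. ennreal (g x))"
    using assms(2-4) by (simp add: nondegenerate_gaussian_def g_def)
  have g0: "g x \<ge> 0" for x
    using gaussian_density_nonneg[OF assms(1)] X unfolding g_def by blast
  have g_minus: "g (- x) = g x" for x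
    by (simp add: g_def gaussian_density_minus)
  have g_translate: "g (s *\<^sub>R u + x) = exp (- s\<^sup>2 * q / 2) * (g x * exp (- s * b x))" for s x
    unfolding g_def q_def b_def using assms(4,5) covariance_matrix_symmetric
    by (intro gaussian_density_translate) auto
  have gm: "g \<in> borel_measurable lborel"
    using X g0 by (intro distributed_real_measurable) auto
  have gl[measurable]: "g \<in> borel_measurable lebesgue"
    using gm by (rule measurable_completion)
  have "b \<in> borel_measurable lborel"
    unfolding b_def by simp
  then have b[measurable]: "b \<in> borel_measurable lebesgue"
    by (rule measurable_completion)
  have wm[measurable]: "w \<in> borel_measurable lebesgue"
    by (rule unimodal_lebesgue_measurable[OF assms(8)])
  have w_shift: "(\<lambda>x. w (x - s *\<^sub>R u)) \<in> borel_measurable lebesgue" for s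
    using measurable_compose[OF lebesgue_measurable_affine[of 1 "- s *\<^sub>R u"] wm] by simp
  have w_le: "w x \<le> w 0" for x
    by (rule even_unimodal_le_at_zero[OF assms(7,8)])

  interpret C: prob_space "completion M"
    by (rule prob_space.prob_space_completion[OF assms(1)])
  have "integrable (completion M) (\<lambda>\<omega>. w (X \<omega> - s *\<^sub>R u))" for s
    using assms(6) w_le
      measurable_compose[OF distributed_measurable_completion[OF X] w_shift]
    by (intro C.integrable_const_bound[where B = "w 0"]) auto
  moreover
  have F_eq: "expect M (\<lambda>\<omega>. w (X \<omega> - s *\<^sub>R u)) = exp (- s\<^sup>2 * q / 2) * G (- s)" for s
  proof -
    have "expect M (\<lambda>\<omega>. w (X \<omega> - s *\<^sub>R u)) = (\<integral>x. g x * w (x - s *\<^sub>R u) \<partial>lebesgue)"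
      by (rule expect_eq_lebesgue_integral[OF X g0 w_shift])
    also have "\<dots> = (\<integral>x. g (s *\<^sub>R u + x) * w x \<partial>lebesgue)"
      using integral_lebesgue_affine[of 1 "\<lambda>x. g x * w (x - s *\<^sub>R u)" "s *\<^sub>R u"] w_shift
      by simp
    also have "\<dots> = (\<integral>x. exp (- s\<^sup>2 * q / 2) * (g x * w x * exp (- s * b x)) \<partial>lebesgue)"
      by (simp add: g_translate mult_ac)
    finally show ?thesis
      by (simp add: G_def)
  qed
  have G_even: "G (- s) = G s" for s
  proof -
    have "b (- x) = - b x" for x by (simp add: b_def)
    then show ?thesis
      using integral_lebesgue_affine[of "-1" "\<lambda>x. g x * w x * exp (s * b x)" 0] assms(7)
      by (simp add: G_def g_minus even_function_def)
  qed

  have int: "integrable lebesgue (\<lambda>x. g x * w x * exp (s * b x))" for s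
  proof -
    interpret prob_space M by fact
    have "integrable lborel g"
      using distributed_integrable[OF X, of "\<lambda>_. 1"] g0 by simp
    then have "integrable lebesgue g"
      using integrable_completion gm by blast
    then have "integrable lebesgue (\<lambda>x. g ((- s) *\<^sub>R u + x))"
      using integrable_lebesgue_affine[of 1 g "(- s) *\<^sub>R u"] by simp
    \<comment> \<open>the tilted density \<open>g exp (s b)\<close> is, up to a constant, a translate of \<open>g\<close>\<close>
    then have "integrable lebesgue (\<lambda>x. g x * exp (s * b x))"
      unfolding g_translate by simp
    then have "integrable lebesgue (\<lambda>x. w 0 * (g x * exp (s * b x)))"
      by (rule integrable_mult_right)
    then show ?thesis
    proof (rule Bochner_Integration.integrable_bound)
      show "AE x in lebesgue. norm (g x * w x * exp (s * b x)) \<le> norm (w 0 * (g x * exp (s * b x)))"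
      proof (rule AE_I2)
        fix x
        have "w x * (g x * exp (s * b x)) \<le> w 0 * (g x * exp (s * b x))"
          using w_le g0 by (intro mult_right_mono) auto
        then show "norm (g x * w x * exp (s * b x)) \<le> norm (w 0 * (g x * exp (s * b x)))"
          using g0 assms(6) by (simp add: abs_mult mult_ac)
      qed
    qed measurable
  qed
  have deriv_G: "(G has_real_derivative D s) (at s)" for s
    unfolding G_def D_def by (rule DERIV_mgf[OF b int])
  have D_nonneg: "D t \<ge> 0" if "t \<ge> 0" for t
    unfolding D_def
  proof (rule even_mgf_deriv_nonneg[OF b int])
    show "(\<integral>x. g x * w x * exp (- s * b x) \<partial>lebesgue) = (\<integral>x. g x * w x * exp (s * b x) \<partial>lebesgue)" for s
      using G_even[of s] unfolding G_def .
  qed (use that g0 assms(6) in auto)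

  let ?F = "\<lambda>s. expect M (\<lambda>\<omega>. w (X \<omega> - s *\<^sub>R u))"
  have F: "?F = (\<lambda>s. exp (- s\<^sup>2 * q / 2) * G s)"
    by (simp add: fun_eq_iff F_eq G_even)
  have deriv_F: "(?F has_real_derivative - t * q * ?F t + exp (- t\<^sup>2 * q / 2) * D t) (at t)" for t
    unfolding fun_cong[OF F, of t] unfolding F
    by (auto intro!: derivative_eq_intros deriv_G)
  have "?F differentiable (at t)" for t
    using deriv_F real_differentiable_def by blast
  moreover have "deriv ?F t \<ge> - t * q * ?F t" if "t \<ge> 0" for t
    using DERIV_imp_deriv[OF deriv_F[of t]] D_nonneg[OF that] by simp
  ultimately show ?thesis
    unfolding q_def by blast
qed

end
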